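(* Let $S$ be an Arf numerical semigroup with multiplicity $3$ and conductor $s>3$. If $s\equiv 2\bmod 3$, then $S=\langle 3,s,s+2\rangle$, $\mathrm{PF}(S)=\{s-3,s-1\}$, and the unique row-factorization matrices of $s-3$ and of $s-1$ are, respectively, \[\begin{bmatrix}-1&1&0\\ \frac{s-5}{3}&-1&1\\ \frac{2s-1}{3}&0&-1\end{bmatrix}\quad\text{and}\quad \begin{bmatrix}-1&0&1\\ \frac{2s-1}{3}&-1&0\\ \frac{s+1}{3}&1&-1\end{bmatrix}.\]
   Context: A numerical semigroup is a subset $S\subseteq\mathbb{N}_0$ (non-negative integers) containing $0$, closed under addition, with finite complement in $\mathbb{N}_0$; $\langle A\rangle$ is the set of $\mathbb{N}_0$-linear combinations of elements of $A$. The multiplicity is the smallest nonzero element of $S$; the conductor is one plus the greatest integer not in $S$. $S$ is Arf if $s_2+s_3-s_1\in S$ for all $s_1\le s_2\le s_3$ in $S$. $\mathrm{PF}(S)$ is the set of integers $z\notin S$ with $z+x\in S$ for all nonzero $x\in S$. If $n_1<\dots<n_e$ are the minimal generators of $S$, a row-factorization matrix of $f\in\mathrm{PF}(S)$ is an $e\times e$ integer matrix $[a_{ij}]$ with $a_{ii}=-1$, $a_{ij}\in\mathbb{N}_0$ for $i\ne j$, and $f=\sum_{j=1}^e a_{ij}n_j$ for each $i$. *)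

theory Defs
  imports Main "Jordan_Normal_Form.Matrix"
begin

definition numerical_semigroup :: "nat set \<Rightarrow> bool" where
  "numerical_semigroup S \<longleftrightarrow>
     0 \<in> S \<and> (\<forall>x\<in>S. \<forall>y\<in>S. x + y \<in> S) \<and> finite (- S)"

definition generated :: "nat set \<Rightarrow> nat set" where
  "generated A = {n. \<exists>F c. finite F \<and> F \<subseteq> A \<and> n = (\<Sum>a\<in>F. c a * a)}"

definition multiplicity_of :: "nat set \<Rightarrow> nat" where
  "multiplicity_of S = (LEAST x. x \<in> S \<and> x \<noteq> 0)"

(* The greatest integer not in S is taken over all integers, so it is -1 (and the conductor
   is 0) when S consists of all natural numbers. *)
definition conductor :: "nat set \<Rightarrow> int" where
  "conductor S = 1 + (GREATEST z. z \<notin> int ` S)"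

(* Since s1 <= s2, the subtraction of natural numbers does not truncate. *)
definition arf :: "nat set \<Rightarrow> bool" where
  "arf S \<longleftrightarrow>
     (\<forall>s1\<in>S. \<forall>s2\<in>S. \<forall>s3\<in>S. s1 \<le> s2 \<and> s2 \<le> s3 \<longrightarrow> s2 + s3 - s1 \<in> S)"

definition PF :: "nat set \<Rightarrow> int set" where
  "PF S = {z. z \<notin> int ` S \<and> (\<forall>x\<in>S. x \<noteq> 0 \<longrightarrow> z + int x \<in> int ` S)}"

definition minimal_generating_set :: "nat set \<Rightarrow> nat set \<Rightarrow> bool" where
  "minimal_generating_set S A \<longleftrightarrow>
     generated A = S \<and> (\<forall>B. B \<subset> A \<longrightarrow> generated B \<noteq> S)"

(* The strictly increasing list ns enumerates the minimal generators. A numerical semigroup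
   has exactly one minimal generating set, which is finite, so ns is determined by S. *)
definition row_factorization_matrix :: "nat set \<Rightarrow> int \<Rightarrow> int mat \<Rightarrow> bool" where
  "row_factorization_matrix S f M \<longleftrightarrow> f \<in> PF S \<and>
     (\<exists>ns. sorted_wrt (<) ns \<and> minimal_generating_set S (set ns) \<and>
        M \<in> carrier_mat (length ns) (length ns) \<and>
        (\<forall>i<length ns. M $$ (i, i) = - 1) \<and>
        (\<forall>i<length ns. \<forall>j<length ns. i \<noteq> j \<longrightarrow> M $$ (i, j) \<ge> 0) \<and>
        (\<forall>i<length ns. f = (\<Sum>j<length ns. M $$ (i, j) * int (ns ! j))))"

end

theory Submission
  imports Defs
begin

text \<open>
  Everything follows from one description of \<open>S\<close>: an Arf semigroup of multiplicity \<open>3\<close> and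
  conductor \<open>s\<close> consists of the multiples of \<open>3\<close> and of all integers from \<open>s\<close> on
  (\<open>arf_multiplicity_3_eq\<close>). Indeed, an element \<open>x\<close> of \<open>S\<close> that is not divisible by \<open>3\<close> lies next
  to a multiple of \<open>3\<close>, and the Arf property applied to \<open>x\<close> and that multiple reflects one in the
  other; this produces a third residue class modulo \<open>3\<close>, so that \<open>S\<close> contains everything above
  \<open>x\<close>, which is impossible below the conductor.

  For \<open>s\<close> congruent to \<open>2\<close> modulo \<open>3\<close>, the least elements of \<open>S\<close> in the three residue classes
  are \<open>0\<close>, \<open>s\<close> and \<open>s + 2\<close>. Hence \<open>3\<close>, \<open>s\<close>, \<open>s + 2\<close> generate \<open>S\<close>, and none of them is a sum
  of two nonzero elements of \<open>S\<close>. An element of this kind belongs to every generating set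
  (\<open>irreducible_in_generating_set\<close>), so these three numbers form the only minimal
  generating set. Subtracting \<open>3\<close> from \<open>s\<close> and from \<open>s + 2\<close> gives the two pseudo-Frobenius
  numbers. Moving the entry \<open>-1\<close> of a row to the other side turns the row into a
  factorization of a number smaller than \<open>3 s\<close> into the other two generators. There the
  coefficients of \<open>s\<close> and \<open>s + 2\<close> are at most \<open>2\<close>, and comparing sizes and residues modulo \<open>3\<close>
  leaves a single possibility in each row.
\<close>

section \<open>Generating sets\<close>

lemma generated_finite_eq:
  assumes "finite A"
  shows "generated A = {n. \<exists>c. n = (\<Sum>a\<in>A. c a * a)}"
proof (intro Set.set_eqI iffI)
  fix n assume "n \<in> generated A"
  then obtain F c where F: "F \<subseteq> A" "n = (\<Sum>a\<in>F. c a * a)"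
    unfolding generated_def by blast
  have "n = (\<Sum>a\<in>A. (if a \<in> F then c a else 0) * a)"
    unfolding F(2) using assms F(1) by (intro sum.mono_neutral_cong_left) auto
  then show "n \<in> {n. \<exists>c. n = (\<Sum>a\<in>A. c a * a)}" by (intro CollectI exI)
next
  fix n assume "n \<in> {n. \<exists>c. n = (\<Sum>a\<in>A. c a * a)}"
  then show "n \<in> generated A" using assms unfolding generated_def by blast
qed

lemma generated_three_eq:
  assumes "a \<noteq> b" "a \<noteq> c" "b \<noteq> c"
  shows "generated {a, b, c} = {n. \<exists>x y z. n = x * a + y * b + z * c}"
proof (intro Set.set_eqI iffI)
  fix n assume "n \<in> generated {a, b, c}"
  then obtain k where "n = (\<Sum>a\<in>{a, b, c}. k a * a)"
    by (auto simp: generated_finite_eq)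
  then have "n = k a * a + k b * b + k c * c" using assms by simp
  then show "n \<in> {n. \<exists>x y z. n = x * a + y * b + z * c}" by blast
next
  fix n assume "n \<in> {n. \<exists>x y z. n = x * a + y * b + z * c}"
  then obtain x y z where n: "n = x * a + y * b + z * c" by blast
  define k where "k = (\<lambda>t. if t = a then x else if t = b then y else z)"
  have "n = (\<Sum>a\<in>{a, b, c}. k a * a)" using n assms by (simp add: k_def)
  then show "n \<in> generated {a, b, c}" by (auto simp: generated_finite_eq)
qed

lemma generator_in_generated: "a \<in> A \<Longrightarrow> a \<in> generated A"
  unfolding generated_def by (intro CollectI exI[of _ "{a}"] exI[of _ "\<lambda>_. 1"]) auto

text \<open>
  A factorization of a nonzero number uses some nonzero generator. Splitting off one copy of
  it writes the number as a sum of two elements, so for an irreducible number the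
  second summand vanishes and the number is that generator.
\<close>
lemma irreducible_in_generating_set:
  assumes "n \<in> generated A" "n \<noteq> 0"
    and irr: "\<And>x y. x \<in> generated A \<Longrightarrow> y \<in> generated A \<Longrightarrow> x \<noteq> 0 \<Longrightarrow> y \<noteq> 0 \<Longrightarrow> n \<noteq> x + y"
  shows "n \<in> A"
proof -
  obtain F c where F: "finite F" "F \<subseteq> A" and n: "n = (\<Sum>a\<in>F. c a * a)"
    using assms(1) unfolding generated_def by blast
  obtain a where a: "a \<in> F" "c a * a \<noteq> 0"
    using assms(2) n by (metis (no_types, lifting) sum.neutral)
  define r where "r = (\<Sum>b\<in>F. (c(a := c a - 1)) b * b)"
  have "n = c a * a + (\<Sum>b\<in>F - {a}. c b * b)"
    unfolding n using F(1) a(1) by (rule sum.remove)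
  moreover have "r = (c a - 1) * a + (\<Sum>b\<in>F - {a}. c b * b)"
    unfolding r_def using F(1) a(1) by (subst sum.remove[of _ a]) auto
  moreover have "c a * a = a + (c a - 1) * a"
    using a(2) by (cases "c a") auto
  ultimately have "n = a + r" by simp
  moreover have "r \<in> generated A" using F unfolding generated_def r_def by blast
  moreover have "a \<in> generated A" using a F by (blast intro: generator_in_generated)
  ultimately have "n = a" using irr[of a r] a(2) by auto
  then show ?thesis using a F by blast
qed

section \<open>Arf semigroups of multiplicity 3\<close>

lemma conductor_nat:
  assumes "numerical_semigroup S" "conductor S = int s"
  shows "\<And>n. s \<le> n \<Longrightarrow> n \<in> S" and "0 < s \<Longrightarrow> s - 1 \<notin> S"
proof -
  \<comment> \<open>The value \<open>-1\<close> is the greatest gap when \<open>S\<close> is all of \<open>\<nat>\<close>.\<close>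
  define G where "G = insert (- 1) (int ` (- S))"
  have fin: "finite G" using assms(1) by (simp add: G_def numerical_semigroup_def)
  have gap_le: "z \<le> Max G" if "z \<notin> int ` S" for z
  proof (cases "z < 0")
    case True
    then show ?thesis using Max_ge[OF fin, of "- 1"] by (simp add: G_def)
  next
    case False
    then have "z = int (nat z)" by simp
    then have "z \<in> G" using that unfolding G_def by blast
    then show ?thesis using fin by simp
  qed
  have "Max G \<in> G" using fin by (intro Max_in) (auto simp: G_def)
  then have gap: "Max G \<notin> int ` S" by (auto simp: G_def)
  have "(GREATEST z. z \<notin> int ` S) = Max G"
    using gap gap_le by (rule Greatest_equality)
  then have max: "Max G = int s - 1" using assms(2) by (simp add: conductor_def)
  show "n \<in> S" if "s \<le> n" for n
    using gap_le[of "int n"] that max by (auto simp: image_iff)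
  show "s - 1 \<notin> S" if "0 < s"
    using gap that unfolding max by (auto simp: image_iff of_nat_diff)
qed

lemma closed_add_multiple_3:
  fixes x k :: nat
  assumes "\<forall>x\<in>S. \<forall>y\<in>S. x + y \<in> S" "3 \<in> S" "x \<in> S"
  shows "x + 3 * k \<in> S"
proof (induction k)
  case (Suc k)
  then have "x + 3 * k + 3 \<in> S" using assms by blast
  then show ?case by (simp add: algebra_simps)
qed (use assms in simp)

lemma closed_three_consecutive:
  fixes x n :: nat
  assumes "\<forall>x\<in>S. \<forall>y\<in>S. x + y \<in> S" "3 \<in> S" "x \<in> S" "x + 1 \<in> S" "x + 2 \<in> S" "x \<le> n"
  shows "n \<in> S"
proof -
  define q r where "q = (n - x) div 3" and "r = (n - x) mod 3"
  have n: "n = (x + r) + 3 * q" using assms(6) unfolding q_def r_def by simp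
  have "r < 3" unfolding r_def by simp
  then have "r = 0 \<or> r = 1 \<or> r = 2" by linarith
  then have "x + r \<in> S" using assms by auto
  then show ?thesis unfolding n using assms by (intro closed_add_multiple_3)
qed

lemma arf_multiplicity_3_eq:
  assumes "numerical_semigroup S" "arf S" "multiplicity_of S = 3" "conductor S = int s"
  shows "S = {n. 3 dvd n \<or> s \<le> n}"
proof -
  have zero: "0 \<in> S" and add: "\<forall>x\<in>S. \<forall>y\<in>S. x + y \<in> S"
    using assms(1) by (auto simp: numerical_semigroup_def)
  have "\<exists>x. x \<in> S \<and> x \<noteq> 0"
    using conductor_nat(1)[OF assms(1,4), of "Suc s"] by (intro exI[of _ "Suc s"]) simp
  then have "(LEAST x. x \<in> S \<and> x \<noteq> 0) \<in> S"
    using LeastI_ex[of "\<lambda>x. x \<in> S \<and> x \<noteq> 0"] by blast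
  then have three: "3 \<in> S" using assms(3) by (simp add: multiplicity_of_def)
  have mult: "3 * k \<in> S" for k :: nat
    using closed_add_multiple_3[OF add three zero, of k] by simp
  have arf: "b + c - a \<in> S" if "a \<in> S" "b \<in> S" "c \<in> S" "a \<le> b" "b \<le> c" for a b c
    using assms(2) that unfolding arf_def by blast
  have above: "s \<le> x" if x: "x \<in> S" "\<not> 3 dvd x" for x
  proof -
    define k where "k = x div 3"
    have "x = 3 * k + 1 \<or> x = 3 * k + 2" using x(2) unfolding k_def by presburger
    then have "n \<in> S" if "x \<le> n" for n
    proof
      assume eq: "x = 3 * k + 1"
      \<comment> \<open>Reflect \<open>3 * k\<close> in \<open>x\<close>.\<close>
      have "x + 1 \<in> S" using arf[of "3 * k" x x] mult x eq by simp
      moreover have "x + 2 \<in> S" using mult[of "k + 1"] eq by (simp add: eval_nat_numeral)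
      ultimately show ?thesis using add three x(1) that
        by (intro closed_three_consecutive[of S x n])
    next
      assume eq: "x = 3 * k + 2"
      have succ: "x + 1 \<in> S" using mult[of "k + 1"] eq by (simp add: eval_nat_numeral)
      \<comment> \<open>Reflect \<open>x\<close> in \<open>x + 1\<close>, which is a multiple of \<open>3\<close>.\<close>
      moreover have "x + 2 \<in> S" using arf[of x "x + 1" "x + 1"] succ x by simp
      ultimately show ?thesis using add three x(1) that
        by (intro closed_three_consecutive[of S x n])
    qed
    then show ?thesis using conductor_nat(2)[OF assms(1,4)] by (cases "s \<le> x") auto
  qed
  show ?thesis
    using above mult conductor_nat(1)[OF assms(1,4)] by (auto elim!: dvdE)
qed

section \<open>Minimal generators and pseudo-Frobenius numbers\<close>

lemma generated_3_s_eq: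
  fixes s :: nat
  assumes "3 < s" "s mod 3 = 2"
  shows "generated {3, s, s + 2} = {n. 3 dvd n \<or> s \<le> n}"
proof -
  have gen: "generated {3, s, s + 2} = {n. \<exists>x y z. n = x * 3 + y * s + z * (s + 2)}"
    using assms by (intro generated_three_eq) auto
  show ?thesis unfolding gen
  proof (intro Set.set_eqI iffI)
    fix n assume "n \<in> {n. \<exists>x y z. n = x * 3 + y * s + z * (s + 2)}"
    then obtain x y z where n: "n = x * 3 + y * s + z * (s + 2)" by blast
    show "n \<in> {n. 3 dvd n \<or> s \<le> n}"
    proof (cases "y = 0 \<and> z = 0")
      case True
      then show ?thesis using n by simp
    next
      case False
      then have "s \<le> y * s + z * (s + 2)" by (cases y; cases z) auto
      then show ?thesis using n by simp
    qed
  next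
    fix n assume n: "n \<in> {n. 3 dvd n \<or> s \<le> n}"
    have "n mod 3 = 0 \<or> n mod 3 = 1 \<or> n mod 3 = 2" by presburger
    then consider (0) "3 dvd n" | (1) "n mod 3 = 1" "s \<le> n" | (2) "n mod 3 = 2" "s \<le> n"
      using n by auto
    then show "n \<in> {n. \<exists>x y z. n = x * 3 + y * s + z * (s + 2)}"
    proof cases
      case 0
      then have "n = n div 3 * 3 + 0 * s + 0 * (s + 2)" by simp
      then show ?thesis by blast
    next
      case 1
      have le: "s + 2 \<le> n" and "3 dvd n - (s + 2)" using 1 assms by presburger+
      then have "(n - (s + 2)) div 3 * 3 = n - (s + 2)" by (simp only: dvd_div_mult_self)
      then have "n = (n - (s + 2)) div 3 * 3 + 0 * s + 1 * (s + 2)"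
        using le by (simp only: mult_zero_left mult_1 add_0_right le_add_diff_inverse2)
      then show ?thesis by blast
    next
      case 2
      have "3 dvd n - s" using 2 assms by presburger
      then have "n = (n - s) div 3 * 3 + 1 * s + 0 * (s + 2)" using 2 by simp
      then show ?thesis by blast
    qed
  qed
qed

text \<open>
  The generators \<open>3\<close>, \<open>s\<close>, \<open>s + 2\<close> are irreducible, so every generating set contains them. As
  they already generate the semigroup, a minimal generating set contains nothing else.
\<close>
lemma minimal_generating_set_3_s_iff:
  fixes s :: nat
  assumes "3 < s" "s mod 3 = 2"
  shows "minimal_generating_set {n. 3 dvd n \<or> s \<le> n} A \<longleftrightarrow> A = {3, s, s + 2}"
proof -
  let ?S = "{n. 3 dvd n \<or> s \<le> n}"
  have sub: "{3, s, s + 2} \<subseteq> B" if B: "generated B = ?S" for B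
  proof
    fix n assume n: "n \<in> {3, s, s + 2}"
    have pos: "3 \<le> x" if "x \<in> ?S" "x \<noteq> 0" for x
      using that assms(1) by (auto dest: dvd_imp_le)
    show "n \<in> B"
    proof (rule irreducible_in_generating_set)
      show "n \<in> generated B" "n \<noteq> 0" using n assms(1) unfolding B by auto
      fix x y assume xy: "x \<in> generated B" "y \<in> generated B" "x \<noteq> 0" "y \<noteq> 0"
      have ge: "3 \<le> x" "3 \<le> y" using pos xy unfolding B by auto
      show "n \<noteq> x + y"
      proof
        assume eq: "n = x + y"
        \<comment> \<open>Each summand is at most \<open>s - 1\<close>, hence a multiple of \<open>3\<close>, whereas \<open>s\<close> and \<open>s + 2\<close>
          are not.\<close>
        have "x < s" "y < s" using eq ge n assms(1) by auto
        then have "3 dvd x" "3 dvd y" using xy unfolding B by auto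
        then have "3 dvd n" using eq by simp
        moreover have "\<not> 3 dvd s" "\<not> 3 dvd s + 2" using assms(2) by presburger+
        ultimately show False using n eq ge by auto
      qed
    qed
  qed
  show ?thesis
    using sub generated_3_s_eq[OF assms] unfolding minimal_generating_set_def by blast
qed

text \<open>
  Adding the generator \<open>3\<close> to a pseudo-Frobenius number \<open>z\<close> already forces \<open>z \<ge> s - 3\<close>, apart
  from \<open>z = -3\<close>; that case is excluded by adding \<open>s\<close>, since \<open>s - 3\<close> is a gap. From \<open>s - 3\<close> on,
  the only gaps are \<open>s - 3\<close> and \<open>s - 1\<close>.
\<close>
lemma PF_3_s_eq:
  fixes s :: nat
  assumes "3 < s" "s mod 3 = 2"
  shows "PF {n. 3 dvd n \<or> s \<le> n} = {int s - 3, int s - 1}"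
proof -
  let ?S = "{n. 3 dvd n \<or> s \<le> n}"
  have mem: "z \<in> int ` ?S \<longleftrightarrow> 0 \<le> z \<and> (3 dvd z \<or> int s \<le> z)" for z
  proof
    assume "z \<in> int ` ?S"
    then obtain n where n: "z = int n" "3 dvd n \<or> s \<le> n" by blast
    then have "3 dvd z \<or> int s \<le> z" by presburger
    then show "0 \<le> z \<and> (3 dvd z \<or> int s \<le> z)" using n by simp
  next
    assume z: "0 \<le> z \<and> (3 dvd z \<or> int s \<le> z)"
    then obtain n where n: "z = int n" using nonneg_int_cases by blast
    then have "3 dvd n \<or> s \<le> n" using z by presburger
    then show "z \<in> int ` ?S" using n by blast
  qed
  show ?thesis
  proof (intro Set.set_eqI iffI)
    fix z assume "z \<in> PF ?S"
    then have gap: "z \<notin> int ` ?S" and shift: "\<And>x. x \<in> ?S \<Longrightarrow> x \<noteq> 0 \<Longrightarrow> z + int x \<in> int ` ?S"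
      unfolding PF_def by auto
    have "z + 3 \<in> int ` ?S" "z + int s \<in> int ` ?S"
      using shift[of 3] shift[of s] assms(1) by auto
    with gap have "z = int s - 3 \<or> z = int s - 1"
      unfolding mem using assms by presburger
    then show "z \<in> {int s - 3, int s - 1}" by simp
  next
    fix z assume "z \<in> {int s - 3, int s - 1}"
    then have z: "z = int s - 3 \<or> z = int s - 1" by simp
    have "z \<notin> int ` ?S" unfolding mem using z assms by presburger
    moreover have "z + int x \<in> int ` ?S" if "x \<in> ?S" "x \<noteq> 0" for x
    proof -
      have "3 \<le> x" using that assms(1) by (auto dest: dvd_imp_le)
      then show ?thesis unfolding mem using z assms(1) by auto
    qed
    ultimately show "z \<in> PF ?S" unfolding PF_def by blast
  qed
qed

section \<open>Row-factorization matrices\<close>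

lemma row_factorization_matrix_unique_generators:
  assumes "sorted_wrt (<) ns" "\<And>A. minimal_generating_set S A \<longleftrightarrow> A = set ns"
  shows "row_factorization_matrix S f M \<longleftrightarrow> f \<in> PF S \<and>
     M \<in> carrier_mat (length ns) (length ns) \<and>
     (\<forall>i<length ns. M $$ (i, i) = - 1) \<and>
     (\<forall>i<length ns. \<forall>j<length ns. i \<noteq> j \<longrightarrow> M $$ (i, j) \<ge> 0) \<and>
     (\<forall>i<length ns. f = (\<Sum>j<length ns. M $$ (i, j) * int (ns ! j)))"
proof -
  have uniq: "sorted_wrt (<) ns' \<and> minimal_generating_set S (set ns') \<longleftrightarrow> ns' = ns" for ns'
    using assms strict_sorted_equal by auto
  have ex: "(\<exists>ns'. sorted_wrt (<) ns' \<and> minimal_generating_set S (set ns') \<and> P ns') \<longleftrightarrow> P ns"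
    for P
    unfolding conj_assoc[symmetric] uniq by simp
  show ?thesis unfolding row_factorization_matrix_def ex ..
qed

lemma mat_of_rows_list_3_eq_iff:
  "M = mat_of_rows_list 3 [[a, b, c], [d, e, f], [g, h, k]] \<longleftrightarrow>
     M \<in> carrier_mat 3 3 \<and>
     M $$ (0, 0) = a \<and> M $$ (0, 1) = b \<and> M $$ (0, 2) = c \<and>
     M $$ (1, 0) = d \<and> M $$ (1, 1) = e \<and> M $$ (1, 2) = f \<and>
     M $$ (2, 0) = g \<and> M $$ (2, 1) = h \<and> M $$ (2, 2) = k"
  (is "M = ?N \<longleftrightarrow> ?R")
proof
  assume "M = ?N"
  moreover have "?N \<in> carrier_mat 3 3"
    by (rule carrier_matI) (simp_all add: mat_of_rows_list_def)
  ultimately show ?R by (simp add: mat_of_rows_list_def)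
next
  assume R: ?R
  show "M = ?N"
  proof (rule eq_matI)
    fix i j assume "i < dim_row ?N" "j < dim_col ?N"
    then have ij: "i < 3" "j < 3" by (simp_all add: mat_of_rows_list_def)
    then have "i = 0 \<or> i = 1 \<or> i = 2" "j = 0 \<or> j = 1 \<or> j = 2" by linarith+
    then show "M $$ (i, j) = ?N $$ (i, j)" using R by (auto simp: mat_of_rows_list_def)
  qed (use R in \<open>auto simp: mat_of_rows_list_def\<close>)
qed

text \<open>
  Once the generators are known, the conditions on a row-factorization matrix concern its rows
  one at a time, so the matrix is unique as soon as each row equation has a unique solution.
\<close>
lemma row_factorization_matrix_three:
  fixes n1 n2 n3 :: nat
  assumes "n1 < n2" "n2 < n3" "\<And>A. minimal_generating_set S A \<longleftrightarrow> A = {n1, n2, n3}"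
    and "f \<in> PF S"
    and "\<And>b c. 0 \<le> b \<and> 0 \<le> c \<and> f = - int n1 + b * int n2 + c * int n3 \<longleftrightarrow> b = b1 \<and> c = c1"
    and "\<And>a c. 0 \<le> a \<and> 0 \<le> c \<and> f = a * int n1 - int n2 + c * int n3 \<longleftrightarrow> a = a2 \<and> c = c2"
    and "\<And>a b. 0 \<le> a \<and> 0 \<le> b \<and> f = a * int n1 + b * int n2 - int n3 \<longleftrightarrow> a = a3 \<and> b = b3"
  shows "row_factorization_matrix S f M \<longleftrightarrow>
    M = mat_of_rows_list 3 [[- 1, b1, c1], [a2, - 1, c2], [a3, b3, - 1]]"
proof -
  have all3: "(\<forall>i<3. P i) \<longleftrightarrow> P 0 \<and> P 1 \<and> P 2" for P :: "nat \<Rightarrow> bool"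
    by (simp add: numeral_3_eq_3 numeral_2_eq_2 All_less_Suc conj_ac)
  have sum3: "(\<Sum>j<3. g j) = g 0 + g 1 + g 2" for g :: "nat \<Rightarrow> int"
    by (simp add: numeral_3_eq_3 numeral_2_eq_2)
  have len: "length [n1, n2, n3] = 3" by simp
  have "row_factorization_matrix S f M \<longleftrightarrow> f \<in> PF S \<and>
     M \<in> carrier_mat 3 3 \<and>
     (\<forall>i<3. M $$ (i, i) = - 1) \<and>
     (\<forall>i<3. \<forall>j<3. i \<noteq> j \<longrightarrow> M $$ (i, j) \<ge> 0) \<and>
     (\<forall>i<3. f = (\<Sum>j<3. M $$ (i, j) * int ([n1, n2, n3] ! j)))"
    using row_factorization_matrix_unique_generators[of "[n1, n2, n3]" S f M] assms(1-3)
    unfolding len by simp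
  also have "\<dots> \<longleftrightarrow> M \<in> carrier_mat 3 3 \<and>
     M $$ (0, 0) = - 1 \<and> M $$ (1, 1) = - 1 \<and> M $$ (2, 2) = - 1 \<and>
     (0 \<le> M $$ (0, 1) \<and> 0 \<le> M $$ (0, 2) \<and>
        f = - int n1 + M $$ (0, 1) * int n2 + M $$ (0, 2) * int n3) \<and>
     (0 \<le> M $$ (1, 0) \<and> 0 \<le> M $$ (1, 2) \<and>
        f = M $$ (1, 0) * int n1 - int n2 + M $$ (1, 2) * int n3) \<and>
     (0 \<le> M $$ (2, 0) \<and> 0 \<le> M $$ (2, 1) \<and>
        f = M $$ (2, 0) * int n1 + M $$ (2, 1) * int n2 - int n3)"
    unfolding all3 sum3 using assms(4) by auto
  also have "\<dots> \<longleftrightarrow> M = mat_of_rows_list 3 [[- 1, b1, c1], [a2, - 1, c2], [a3, b3, - 1]]"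
    unfolding assms(5-7) mat_of_rows_list_3_eq_iff by auto
  finally show ?thesis .
qed

text \<open>
  A coefficient \<open>c\<close> of a generator \<open>k\<close> in a factorization of a number below \<open>3 * k\<close> is at
  most \<open>2\<close>; this reduces the equation of each row to finitely many linear cases.
\<close>
lemma coefficient_le_2:
  fixes c k r N :: int
  assumes "0 \<le> r" "0 \<le> c" "r + c * k = N" "0 < k" "N < 3 * k"
  shows "c = 0 \<or> c = 1 \<or> c = 2"
proof -
  have "c * k < 3 * k" using assms by linarith
  then have "c < 3" using assms(4) by (simp add: mult_less_cancel_right)
  then show ?thesis using assms(2) by linarith
qed

lemma row_factorizations_s_minus_3:
  fixes s :: int
  assumes "3 < s" "s mod 3 = 2"
  shows
    "0 \<le> b \<and> 0 \<le> c \<and> s - 3 = - 3 + b * s + c * (s + 2) \<longleftrightarrow> b = 1 \<and> c = 0"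
    "0 \<le> a \<and> 0 \<le> c \<and> s - 3 = a * 3 - s + c * (s + 2) \<longleftrightarrow> a = (s - 5) div 3 \<and> c = 1"
    "0 \<le> a \<and> 0 \<le> b \<and> s - 3 = a * 3 + b * s - (s + 2) \<longleftrightarrow> a = (2 * s - 1) div 3 \<and> b = 0"
proof -
  show "0 \<le> b \<and> 0 \<le> c \<and> s - 3 = - 3 + b * s + c * (s + 2) \<longleftrightarrow> b = 1 \<and> c = 0"
    (is "?L \<longleftrightarrow> ?R")
  proof
    assume L: ?L
    have "b = 0 \<or> b = 1 \<or> b = 2"
      using L assms(1) by (intro coefficient_le_2[of "c * (s + 2)" b s s]) auto
    moreover have "c = 0 \<or> c = 1 \<or> c = 2"
      using L assms(1) by (intro coefficient_le_2[of "b * s" c "s + 2" s]) auto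
    ultimately show ?R using L assms(1) by auto
  qed simp
  show "0 \<le> a \<and> 0 \<le> c \<and> s - 3 = a * 3 - s + c * (s + 2) \<longleftrightarrow> a = (s - 5) div 3 \<and> c = 1"
    (is "?L \<longleftrightarrow> ?R")
  proof
    assume L: ?L
    have "c = 0 \<or> c = 1 \<or> c = 2"
      using L assms(1) by (intro coefficient_le_2[of "a * 3" c "s + 2" "2 * s - 3"]) auto
    then show ?R using L assms by (elim disjE; hypsubst; simp only: mult_zero_left mult_1; presburger)
  next
    assume ?R
    then show ?L using assms by (elim conjE; hypsubst; simp only: mult_1; presburger)
  qed
  show "0 \<le> a \<and> 0 \<le> b \<and> s - 3 = a * 3 + b * s - (s + 2) \<longleftrightarrow> a = (2 * s - 1) div 3 \<and> b = 0"
    (is "?L \<longleftrightarrow> ?R")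
  proof
    assume L: ?L
    have "b = 0 \<or> b = 1 \<or> b = 2"
      using L assms(1) by (intro coefficient_le_2[of "a * 3" b s "2 * s - 1"]) auto
    then show ?R using L assms by (elim disjE; hypsubst; simp only: mult_zero_left mult_1; presburger)
  next
    assume ?R
    then show ?L using assms by (elim conjE; hypsubst; simp only: mult_zero_left; presburger)
  qed
qed

lemma row_factorizations_s_minus_1:
  fixes s :: int
  assumes "3 < s" "s mod 3 = 2"
  shows
    "0 \<le> b \<and> 0 \<le> c \<and> s - 1 = - 3 + b * s + c * (s + 2) \<longleftrightarrow> b = 0 \<and> c = 1"
    "0 \<le> a \<and> 0 \<le> c \<and> s - 1 = a * 3 - s + c * (s + 2) \<longleftrightarrow> a = (2 * s - 1) div 3 \<and> c = 0"
    "0 \<le> a \<and> 0 \<le> b \<and> s - 1 = a * 3 + b * s - (s + 2) \<longleftrightarrow> a = (s + 1) div 3 \<and> b = 1"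
proof -
  show "0 \<le> b \<and> 0 \<le> c \<and> s - 1 = - 3 + b * s + c * (s + 2) \<longleftrightarrow> b = 0 \<and> c = 1"
    (is "?L \<longleftrightarrow> ?R")
  proof
    assume L: ?L
    have "b = 0 \<or> b = 1 \<or> b = 2"
      using L assms(1) by (intro coefficient_le_2[of "c * (s + 2)" b s "s + 2"]) auto
    moreover have "c = 0 \<or> c = 1 \<or> c = 2"
      using L assms(1) by (intro coefficient_le_2[of "b * s" c "s + 2" "s + 2"]) auto
    ultimately show ?R using L assms(1) by auto
  qed simp
  show "0 \<le> a \<and> 0 \<le> c \<and> s - 1 = a * 3 - s + c * (s + 2) \<longleftrightarrow> a = (2 * s - 1) div 3 \<and> c = 0"
    (is "?L \<longleftrightarrow> ?R")
  proof
    assume L: ?L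
    have "c = 0 \<or> c = 1 \<or> c = 2"
      using L assms(1) by (intro coefficient_le_2[of "a * 3" c "s + 2" "2 * s - 1"]) auto
    then show ?R using L assms by (elim disjE; hypsubst; simp only: mult_zero_left mult_1; presburger)
  next
    assume ?R
    then show ?L using assms by (elim conjE; hypsubst; simp only: mult_zero_left; presburger)
  qed
  show "0 \<le> a \<and> 0 \<le> b \<and> s - 1 = a * 3 + b * s - (s + 2) \<longleftrightarrow> a = (s + 1) div 3 \<and> b = 1"
    (is "?L \<longleftrightarrow> ?R")
  proof
    assume L: ?L
    have "b = 0 \<or> b = 1 \<or> b = 2"
      using L assms(1) by (intro coefficient_le_2[of "a * 3" b s "2 * s + 1"]) auto
    then show ?R using L assms by (elim disjE; hypsubst; simp only: mult_zero_left mult_1; presburger)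
  next
    assume ?R
    then show ?L using assms by (elim conjE; hypsubst; simp only: mult_1; presburger)
  qed
qed

section \<open>Conductor congruent to 2 modulo 3\<close>

theorem proposition3p3:
  fixes S :: "nat set" and s :: nat
  assumes "numerical_semigroup S"
    and "arf S"
    and "multiplicity_of S = 3"
    and "conductor S = int s"
    and "s > 3"
    and "s mod 3 = 2"
  shows "S = generated {3, s, s + 2}
    \<and> PF S = {int s - 3, int s - 1}
    \<and> (\<forall>M. row_factorization_matrix S (int s - 3) M \<longleftrightarrow>
          M = mat_of_rows_list 3
            [[- 1, 1, 0],
             [(int s - 5) div 3, - 1, 1],
             [(2 * int s - 1) div 3, 0, - 1]])
    \<and> (\<forall>M. row_factorization_matrix S (int s - 1) M \<longleftrightarrow>
          M = mat_of_rows_list 3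
            [[- 1, 0, 1],
             [(2 * int s - 1) div 3, - 1, 0],
             [(int s + 1) div 3, 1, - 1]])"
proof -
  let ?S = "{n. 3 dvd n \<or> s \<le> n}"
  have S: "S = ?S" using arf_multiplicity_3_eq assms(1-4) by blast
  have gen: "S = generated {3, s, s + 2}" using S generated_3_s_eq assms(5,6) by simp
  have pf: "PF S = {int s - 3, int s - 1}" unfolding S using assms(5,6) by (rule PF_3_s_eq)
  have min: "minimal_generating_set S A \<longleftrightarrow> A = {3, s, s + 2}" for A
    unfolding S using assms(5,6) by (rule minimal_generating_set_3_s_iff)
  have s: "3 < int s" "int s mod 3 = 2" using assms(5,6) by presburger+
  have cast: "int 3 = 3" "int (s + 2) = int s + 2" by simp_all
  have "row_factorization_matrix S (int s - 3) M \<longleftrightarrow>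
      M = mat_of_rows_list 3
        [[- 1, 1, 0], [(int s - 5) div 3, - 1, 1], [(2 * int s - 1) div 3, 0, - 1]]" for M
    by (rule row_factorization_matrix_three[of 3 s "s + 2", unfolded cast,
          OF _ _ min _ row_factorizations_s_minus_3[OF s]])
      (use assms(5) pf in auto)
  moreover have "row_factorization_matrix S (int s - 1) M \<longleftrightarrow>
      M = mat_of_rows_list 3
        [[- 1, 0, 1], [(2 * int s - 1) div 3, - 1, 0], [(int s + 1) div 3, 1, - 1]]" for M
    by (rule row_factorization_matrix_three[of 3 s "s + 2", unfolded cast,
          OF _ _ min _ row_factorizations_s_minus_1[OF s]])
      (use assms(5) pf in auto)
  ultimately show ?thesis using gen pf by blast
qed

end
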